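(* Consider an Exponential Family Bayesian Mixture Model as described in the context, with component densities $g_{\theta}(x)=h(x)\exp\{T(x)^\top\eta(\theta)-B(\theta)\}$, with prior density on the component parameters $$\pi_{\chi,\tau}(\theta)=H(\theta)\exp\{\eta(\theta)^\top\chi-\mathbf{B}(\theta)^\top\tau-A(\chi,\tau)\},\qquad (\chi,\tau)\in\Omega,$$ and with $p_n$ the exchangeable partition prior generated by a probability distribution $\mathcal{P}$ on the simplex $\Delta^m$. Let $x_1,\ldots,x_n\in\mathcal{X}\subseteq\mathbb{R}^d$ be pairwise distinct and let $\hat{\mathcal{I}}$ be a MAP partition of $(x_1,\ldots,x_n)$ in this model. Then the family of clusters $\{\{x_i: i\in I\}: I\in\hat{\mathcal{I}}\}$ is $T$-linearly separable, i.e. for every two distinct clusters $I,J\in\hat{\mathcal{I}}$ there exist $a\in\mathbb{R}^p$ and $b\in\mathbb{R}$ such that $a^\top T(x_i)+b\ge 0$ for all $i\in I$ and $a^\top T(x_j)+b<0$ for all $j\in J$.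
   Context: Notation: $[n]=\{1,\ldots,n\}$; for $\mathbf{x}=(x_1,\ldots,x_n)$ and $I\subseteq[n]$, $\mathbf{x}_I=(x_i)_{i\in I}$. Bayesian Mixture Model. Let $\Theta\subseteq\mathbb{R}^p$ be the parameter space, $\{g_\theta:\theta\in\Theta\}$ a family of probability densities on the observation space, $\pi$ a prior probability density on $\Theta$, $m\in\mathbb{N}\cup\{\infty\}$, and $\mathcal{P}$ a probability distribution on the simplex $\Delta^m=\{(p_i)_{i=1}^m: p_i\ge0,\ \sum_i p_i=1\}$. The model is: $(p_i)_{i=1}^m\sim\mathcal{P}$; independently $\theta_1,\theta_2,\ldots$ i.i.d. from $\pi$; given these, $\phi_1,\ldots,\phi_n$ are i.i.d. from $\sum_{i=1}^m p_i\delta_{\theta_i}$; and, given everything, $x_i\sim g_{\phi_i}$ independently. The clusters are the equivalence classes of the relation $i\sim j\iff\phi_i=\phi_j$ on $[n]$. This gives a random partition of $[n]$; $p_n(\mathcal{I})$ denotes the probability that it equals the partition $\mathcal{I}$. It is exchangeable: $p_n(\mathcal{I})=p_n(\{\sigma(I):I\in\mathcal{I}\})$ for all permutations $\sigma$ of $[n]$. For $k\in\mathbb{N}$ put $$f_k(u_1,\ldots,u_k)=\int_\Theta\pi(\theta)\prod_{i=1}^k g_\theta(u_i)\,d\theta,\qquad f(\mathbf{x}\mid\mathcal{I})=\prod_{I\in\mathcal{I}}f_{|I|}(\mathbf{x}_I).$$ A partition $\hat{\mathcal{I}}$ of $[n]$ is a MAP partition of $\mathbf{x}$ if $p_n(\mathcal{I})f(\mathbf{x}\mid\mathcal{I})\le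 p_n(\hat{\mathcal{I}})f(\mathbf{x}\mid\hat{\mathcal{I}})$ for every partition $\mathcal{I}$ of $[n]$. Exponential family specification. Let $\mathcal{X}\subseteq\mathbb{R}^d$ be the observation space, $\Theta\subseteq\mathbb{R}^p$ open, $T:\mathcal{X}\to\mathbb{R}^p$ a statistic, $h:\mathcal{X}\to\mathbb{R}$ a function whose support has positive Lebesgue measure, $\eta:\Theta\to\mathbb{R}^p$, and $B:\Theta\to\mathbb{R}$ of the form $B(\theta)=\mathbf{a}^\top\mathbf{B}(\theta)$ with $\mathbf{a}\in\mathbb{R}^q$ and $\mathbf{B}=(B_1,\ldots,B_q)^\top:\Theta\to\mathbb{R}^q$. The component densities are $g_\theta(x)=h(x)\exp\{T(x)^\top\eta(\theta)-B(\theta)\}$. Let $H:\Theta\to\mathbb{R}$ and let $$\Omega=\Big\{(\chi,\tau)\in\mathbb{R}^p\times\mathbb{R}^q:\int_\Theta H(\theta)\exp\{\eta(\theta)^\top\chi-\mathbf{B}(\theta)^\top\tau\}\,d\theta<\infty\Big\},$$ assumed nonempty, and $$A(\chi,\tau)=\ln\int_\Theta H(\theta)\exp\{\eta(\theta)^\top\chi-\mathbf{B}(\theta)^\top\tau\}\,d\theta .$$ The prior density is $\pi=\pi_{\chi,\tau}$ for some fixed $(\chi,\tau)\in\Omega$.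
   Formalization: Added, as the claim fails otherwise: for distinct i, j in [n], (T(x_i)-T(x_j))^T η(θ) is not almost surely constant under the prior; and the sum over all partitions of p_n(I) f(x|I) is positive and finite. *)

theory Defs
  imports "HOL-Probability.Probability"
begin

definition prob_density_on :: "'a::euclidean_space set \<Rightarrow> ('a \<Rightarrow> real) \<Rightarrow> bool" where
  "prob_density_on S f \<longleftrightarrow>
     set_borel_measurable borel S f \<and> (\<forall>x\<in>S. 0 \<le> f x) \<and>
     (\<integral>\<^sup>+x\<in>S. ennreal (f x) \<partial>lborel) = 1"

definition density_measure :: "'a::euclidean_space set \<Rightarrow> ('a \<Rightarrow> real) \<Rightarrow> 'a measure" where
  "density_measure S f = density lborel (\<lambda>x. ennreal (f x) * indicator S x)"

text \<open>The number \<open>m\<close> of mixture components may be infinite.\<close>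

definition components :: "enat \<Rightarrow> nat set" where
  "components m = {i. 1 \<le> i \<and> enat i \<le> m}"

definition weight_simplex :: "enat \<Rightarrow> (nat \<Rightarrow> real) set" where
  "weight_simplex m =
     {p \<in> components m \<rightarrow>\<^sub>E UNIV. (\<forall>i\<in>components m. 0 \<le> p i) \<and> (p has_sum 1) (components m)}"

definition distribution_on_simplex :: "enat \<Rightarrow> (nat \<Rightarrow> real) measure \<Rightarrow> bool" where
  "distribution_on_simplex m P \<longleftrightarrow> prob_space P \<and>
     sets P = sets (restrict_space (\<Pi>\<^sub>M i\<in>components m. borel) (weight_simplex m))"

text \<open>The discrete measure \<open>\<Sum>i. p i * \<delta> (\<theta> i)\<close>, as the law of \<open>\<theta> i\<close> for an index \<open>i\<close> drawn
  with probabilities \<open>p\<close>.\<close>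

definition mixing_measure ::
    "enat \<Rightarrow> (nat \<Rightarrow> real) \<Rightarrow> (nat \<Rightarrow> 'a::euclidean_space) \<Rightarrow> 'a measure" where
  "mixing_measure m p \<theta> = distr (density (count_space (components m)) (\<lambda>i. ennreal (p i))) borel \<theta>"

definition clusters :: "nat \<Rightarrow> (nat \<Rightarrow> 'a) \<Rightarrow> nat set set" where
  "clusters n \<phi> = {1..n} // {(i, j). i \<in> {1..n} \<and> j \<in> {1..n} \<and> \<phi> i = \<phi> j}"

text \<open>\<open>partition_prob m P \<Theta> \<pi> n \<I>\<close> is \<open>p\<^sub>n(\<I>)\<close>: the weights \<open>p\<close> follow \<open>P\<close>; independently
  the atoms \<open>\<theta> 1, \<theta> 2, \<dots>\<close> are i.i.d. with density \<open>\<pi>\<close>; conditionally on both,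
  \<open>\<phi> 1, \<dots>, \<phi> n\<close> are i.i.d. from the mixing measure.\<close>

definition partition_prob ::
    "enat \<Rightarrow> (nat \<Rightarrow> real) measure \<Rightarrow> 'a::euclidean_space set \<Rightarrow> ('a \<Rightarrow> real)
      \<Rightarrow> nat \<Rightarrow> nat set set \<Rightarrow> ennreal" where
  "partition_prob m P \<Theta> \<pi> n \<I> =
     (\<integral>\<^sup>+p. (\<integral>\<^sup>+\<theta>.
        emeasure (\<Pi>\<^sub>M i\<in>{1..n}. mixing_measure m p \<theta>)
          {\<phi> \<in> space (\<Pi>\<^sub>M i\<in>{1..n}. mixing_measure m p \<theta>). clusters n \<phi> = \<I>}
      \<partial>(\<Pi>\<^sub>M i\<in>{1..}. density_measure \<Theta> \<pi>)) \<partial>P)"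

text \<open>\<open>cluster_marginal \<Theta> \<pi> g x I\<close> is \<open>f\<^sub>k(x\<^sub>I)\<close> with \<open>k = |I|\<close>; since \<open>f\<^sub>k\<close> is symmetric, its
  arguments are indexed by \<open>I\<close> itself. It takes values in \<open>[0,\<infinity>]\<close>.\<close>

definition cluster_marginal ::
    "'a::euclidean_space set \<Rightarrow> ('a \<Rightarrow> real) \<Rightarrow> ('a \<Rightarrow> 'x \<Rightarrow> real) \<Rightarrow> (nat \<Rightarrow> 'x)
      \<Rightarrow> nat set \<Rightarrow> ennreal" where
  "cluster_marginal \<Theta> \<pi> g x I =
     (\<integral>\<^sup>+\<theta>\<in>\<Theta>. ennreal (\<pi> \<theta> * (\<Prod>i\<in>I. g \<theta> (x i))) \<partial>lborel)"

definition partition_likelihood ::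
    "'a::euclidean_space set \<Rightarrow> ('a \<Rightarrow> real) \<Rightarrow> ('a \<Rightarrow> 'x \<Rightarrow> real) \<Rightarrow> (nat \<Rightarrow> 'x)
      \<Rightarrow> nat set set \<Rightarrow> ennreal" where
  "partition_likelihood \<Theta> \<pi> g x \<I> = (\<Prod>I\<in>\<I>. cluster_marginal \<Theta> \<pi> g x I)"

definition posterior_score ::
    "enat \<Rightarrow> (nat \<Rightarrow> real) measure \<Rightarrow> 'a::euclidean_space set \<Rightarrow> ('a \<Rightarrow> real)
      \<Rightarrow> ('a \<Rightarrow> 'x \<Rightarrow> real) \<Rightarrow> nat \<Rightarrow> (nat \<Rightarrow> 'x) \<Rightarrow> nat set set \<Rightarrow> ennreal" where
  "posterior_score m P \<Theta> \<pi> g n x \<I> =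
     partition_prob m P \<Theta> \<pi> n \<I> * partition_likelihood \<Theta> \<pi> g x \<I>"

definition MAP_partition ::
    "enat \<Rightarrow> (nat \<Rightarrow> real) measure \<Rightarrow> 'a::euclidean_space set \<Rightarrow> ('a \<Rightarrow> real)
      \<Rightarrow> ('a \<Rightarrow> 'x \<Rightarrow> real) \<Rightarrow> nat \<Rightarrow> (nat \<Rightarrow> 'x) \<Rightarrow> nat set set \<Rightarrow> bool" where
  "MAP_partition m P \<Theta> \<pi> g n x \<I>h \<longleftrightarrow> partition_on {1..n} \<I>h \<and>
     (\<forall>\<I>. partition_on {1..n} \<I> \<longrightarrow>
        posterior_score m P \<Theta> \<pi> g n x \<I> \<le> posterior_score m P \<Theta> \<pi> g n x \<I>h)"

text \<open>The marginal density of the data at \<open>x\<close>, i.e. the normalising constant of the posterior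
  distribution over partitions.\<close>

definition evidence ::
    "enat \<Rightarrow> (nat \<Rightarrow> real) measure \<Rightarrow> 'a::euclidean_space set \<Rightarrow> ('a \<Rightarrow> real)
      \<Rightarrow> ('a \<Rightarrow> 'x \<Rightarrow> real) \<Rightarrow> nat \<Rightarrow> (nat \<Rightarrow> 'x) \<Rightarrow> ennreal" where
  "evidence m P \<Theta> \<pi> g n x = (\<Sum>\<I> | partition_on {1..n} \<I>. posterior_score m P \<Theta> \<pi> g n x \<I>)"

definition expfam_density ::
    "('x \<Rightarrow> real) \<Rightarrow> ('x \<Rightarrow> real^'p) \<Rightarrow> ('t \<Rightarrow> real^'p) \<Rightarrow> real^'q \<Rightarrow> ('t \<Rightarrow> real^'q)
      \<Rightarrow> 't \<Rightarrow> 'x \<Rightarrow> real" where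
  "expfam_density h T \<eta> a Bv \<theta> x = h x * exp (T x \<bullet> \<eta> \<theta> - a \<bullet> Bv \<theta>)"

definition conj_integral ::
    "'t::euclidean_space set \<Rightarrow> ('t \<Rightarrow> real) \<Rightarrow> ('t \<Rightarrow> real^'p) \<Rightarrow> ('t \<Rightarrow> real^'q)
      \<Rightarrow> real^'p \<Rightarrow> real^'q \<Rightarrow> ennreal" where
  "conj_integral \<Theta> H \<eta> Bv chi tau =
     (\<integral>\<^sup>+\<theta>\<in>\<Theta>. ennreal (H \<theta> * exp (\<eta> \<theta> \<bullet> chi - Bv \<theta> \<bullet> tau)) \<partial>lborel)"

definition Omega ::
    "'t::euclidean_space set \<Rightarrow> ('t \<Rightarrow> real) \<Rightarrow> ('t \<Rightarrow> real^'p) \<Rightarrow> ('t \<Rightarrow> real^'q)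
      \<Rightarrow> ((real^'p) \<times> (real^'q)) set" where
  "Omega \<Theta> H \<eta> Bv = {(chi, tau). conj_integral \<Theta> H \<eta> Bv chi tau < \<infinity>}"

definition log_partition ::
    "'t::euclidean_space set \<Rightarrow> ('t \<Rightarrow> real) \<Rightarrow> ('t \<Rightarrow> real^'p) \<Rightarrow> ('t \<Rightarrow> real^'q)
      \<Rightarrow> real^'p \<Rightarrow> real^'q \<Rightarrow> real" where
  "log_partition \<Theta> H \<eta> Bv chi tau = ln (enn2real (conj_integral \<Theta> H \<eta> Bv chi tau))"

definition conj_prior ::
    "'t::euclidean_space set \<Rightarrow> ('t \<Rightarrow> real) \<Rightarrow> ('t \<Rightarrow> real^'p) \<Rightarrow> ('t \<Rightarrow> real^'q)
      \<Rightarrow> real^'p \<Rightarrow> real^'q \<Rightarrow> 't \<Rightarrow> real" where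
  "conj_prior \<Theta> H \<eta> Bv chi tau \<theta> =
     H \<theta> * exp (\<eta> \<theta> \<bullet> chi - Bv \<theta> \<bullet> tau - log_partition \<Theta> H \<eta> Bv chi tau)"

definition linearly_separable_via :: "('x \<Rightarrow> real^'p) \<Rightarrow> 'x set set \<Rightarrow> bool" where
  "linearly_separable_via T \<A> \<longleftrightarrow>
     (\<forall>U\<in>\<A>. \<forall>V\<in>\<A>. U \<noteq> V \<longrightarrow>
        (\<exists>(a :: real^'p) (b :: real). (\<forall>u\<in>U. a \<bullet> T u + b \<ge> 0) \<and> (\<forall>v\<in>V. a \<bullet> T v + b < 0)))"

end

theory Submission
  imports Defs
begin

text \<open>
  Take two clusters \<open>I\<close>, \<open>J\<close> of a maximal partition, \<open>i \<in> I\<close> and \<open>j \<in> J\<close>, and swap the two observations.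
  Exchangeability keeps the prior probability of the partition (\<open>partition_prob_permute\<close>), so
  maximality says that the product of the two cluster marginals does not increase (\<open>MAP_swap\<close>). In an
  exponential family the swap preserves the cluster sizes and changes the sufficient statistics by
  \<open>d = T (x j) - T (x i)\<close> and \<open>- d\<close>, so it only multiplies the integrand of the first marginal by
  \<open>exp (d \<bullet> \<eta> \<theta>)\<close> and that of the second by \<open>exp (- (d \<bullet> \<eta> \<theta>))\<close>, up to constants that cancel
  (\<open>prod_expfam_exchange\<close>).

  If \<open>T\<close> does not separate the clusters linearly, the convex hulls of the two finite sets of statistics
  meet, and then some convex combination of the differences \<open>d\<close> vanishes
  (\<open>finite_sets_separable_or_balanced\<close>). This contradicts strict convexity of the logarithm of the
  product of marginals, as a function of the shift \<open>d\<close>: the value at \<open>0\<close> would be at least all the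
  values at points whose weighted mean is \<open>0\<close>. The quantitative form is \<open>tilts_not_increasing_imp_AE_const\<close>,
  which writes the product of two integrals as a double integral and uses \<open>exp t \<ge> 1 + t\<close>
  with equality only at \<open>0\<close>. It yields \<open>i \<in> I\<close> and \<open>j \<in> J\<close> for which \<open>(T (x j) - T (x i)) \<bullet> \<eta> \<theta>\<close> is
  almost surely constant under the prior, which the distinguishability of the observations excludes.
  Positivity and finiteness of the evidence make the maximal score positive and finite, so that common
  factors may be cancelled and equality in an integral inequality is informative.
\<close>

section \<open>A rigidity property of exponential tilts\<close>

text \<open>The convexity bound \<open>1 + t \<le> exp t\<close> at \<open>t / 2\<close>, squared, beats the tangent line by \<open>t\<^sup>2 / 4\<close>;
  squaring needs \<open>1 + t / 2 \<ge> 0\<close>, and below \<open>- 2\<close> the tangent line is negative.\<close>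

lemma exp_eq_one_plus_iff: "exp t = 1 + t \<longleftrightarrow> t = (0::real)"
proof
  assume eq: "exp t = 1 + t"
  show "t = 0"
  proof (cases "t \<le> - 2")
    case True
    then show ?thesis using eq exp_gt_zero[of t] by linarith
  next
    case False
    have "(1 + t / 2)\<^sup>2 \<le> (exp (t / 2))\<^sup>2"
      using False by (intro power_mono exp_ge_add_one_self) auto
    also have "\<dots> = exp t"
      by (simp add: power2_eq_square flip: exp_add)
    finally have "t\<^sup>2 / 4 \<le> 0"
      using eq by (simp add: power2_eq_square field_simps)
    then show ?thesis by simp
  qed
qed simp

lemma convex_sum_exp_ge_one:
  fixes w t :: "'k \<Rightarrow> real"
  assumes "\<And>k. k \<in> K \<Longrightarrow> 0 \<le> w k" and "sum w K = 1" and "(\<Sum>k\<in>K. w k * t k) = 0"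
  shows "1 \<le> (\<Sum>k\<in>K. w k * exp (t k))"
proof -
  have "1 = (\<Sum>k\<in>K. w k * (1 + t k))"
    using assms by (simp add: distrib_left sum.distrib)
  also have "\<dots> \<le> (\<Sum>k\<in>K. w k * exp (t k))"
    using assms(1) by (intro sum_mono mult_left_mono exp_ge_add_one_self)
  finally show ?thesis .
qed

lemma convex_sum_exp_eq_one_imp_zero:
  fixes w t :: "'k \<Rightarrow> real"
  assumes "finite K" and "\<And>k. k \<in> K \<Longrightarrow> 0 \<le> w k" and "sum w K = 1"
    and "(\<Sum>k\<in>K. w k * t k) = 0" and "(\<Sum>k\<in>K. w k * exp (t k)) = 1"
    and "k \<in> K" and "0 < w k"
  shows "t k = 0"
proof -
  have "(\<Sum>k\<in>K. w k * (exp (t k) - (1 + t k))) = 0"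
    using assms(3-5) by (simp add: right_diff_distrib distrib_left sum.distrib sum_subtractf)
  moreover have "0 \<le> w k * (exp (t k) - (1 + t k))" if "k \<in> K" for k
    using assms(2)[OF that] exp_ge_add_one_self[of "t k"] by (intro mult_nonneg_nonneg) linarith+
  ultimately have "w k * (exp (t k) - (1 + t k)) = 0"
    using assms(1,6) sum_nonneg_eq_0_iff by (metis (no_types, lifting))
  then show ?thesis
    using assms(7) exp_eq_one_plus_iff[of "t k"] by simp
qed

lemma nn_integral_product_pair:
  assumes "sigma_finite_measure M"
    and [measurable]: "F \<in> borel_measurable M" "G \<in> borel_measurable M"
  shows "(\<integral>\<^sup>+z. F (fst z) * G (snd z) \<partial>(M \<Otimes>\<^sub>M M)) = (\<integral>\<^sup>+x. F x \<partial>M) * (\<integral>\<^sup>+y. G y \<partial>M)"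
proof -
  interpret sigma_finite_measure M by fact
  have "(\<integral>\<^sup>+z. F (fst z) * G (snd z) \<partial>(M \<Otimes>\<^sub>M M)) = (\<integral>\<^sup>+x. \<integral>\<^sup>+y. F x * G y \<partial>M \<partial>M)"
    by (subst nn_integral_fst[symmetric]) auto
  then show ?thesis
    by (simp add: nn_integral_cmult nn_integral_multc)
qed

text \<open>The products of integrals become integrals over \<open>M \<Otimes> M\<close>, in which the two opposite tilts combine
  to \<open>exp (d k \<bullet> (E \<theta> - E \<theta>'))\<close>. Averaging the hypothesis over \<open>k\<close> with weights \<open>w\<close> bounds the integral of
  \<open>F \<theta> * G \<theta>' * S (\<theta>, \<theta>')\<close>, \<open>S\<close> being the average of these exponentials, by that of \<open>F \<theta> * G \<theta>'\<close>. But the exponents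
  average to \<open>0\<close>, so \<open>S \<ge> 1\<close> pointwise, and hence \<open>S = 1\<close> almost everywhere. Equality in the tangent
  bound forces \<open>d k \<bullet> E \<theta> = d k \<bullet> E \<theta>'\<close> for almost all pairs; fixing one good coordinate gives the constant.
  The argument never integrates \<open>E\<close>, whose mean under \<open>F\<close> or \<open>G\<close> need not exist.\<close>

lemma tilts_not_increasing_imp_AE_const:
  fixes E :: "'a \<Rightarrow> 'v::euclidean_space" and F G :: "'a \<Rightarrow> ennreal"
    and w :: "'k \<Rightarrow> real" and d :: "'k \<Rightarrow> 'v"
  assumes "prob_space M"
    and meas[measurable]: "E \<in> borel_measurable M" "F \<in> borel_measurable M" "G \<in> borel_measurable M"
    and posF: "AE \<theta> in M. 0 < F \<theta>" and posG: "AE \<theta> in M. 0 < G \<theta>"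
    and fin: "(\<integral>\<^sup>+\<theta>. F \<theta> \<partial>M) * (\<integral>\<^sup>+\<theta>. G \<theta> \<partial>M) < \<infinity>"
    and "finite K" and w: "\<And>k. k \<in> K \<Longrightarrow> 0 \<le> w k" "sum w K = 1" "(\<Sum>k\<in>K. w k *\<^sub>R d k) = 0"
    and le: "\<And>k. k \<in> K \<Longrightarrow>
      (\<integral>\<^sup>+\<theta>. F \<theta> * ennreal (exp (d k \<bullet> E \<theta>)) \<partial>M) * (\<integral>\<^sup>+\<theta>. G \<theta> * ennreal (exp (- (d k \<bullet> E \<theta>))) \<partial>M)
        \<le> (\<integral>\<^sup>+\<theta>. F \<theta> \<partial>M) * (\<integral>\<^sup>+\<theta>. G \<theta> \<partial>M)"
    and k: "k \<in> K" "0 < w k"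
  shows "\<exists>c. AE \<theta> in M. d k \<bullet> E \<theta> = c"
proof -
  interpret prob_space M by fact
  interpret P: pair_sigma_finite M M by standard
  define N where "N = M \<Otimes>\<^sub>M M"
  define C where "C = (\<integral>\<^sup>+\<theta>. F \<theta> \<partial>M) * (\<integral>\<^sup>+\<theta>. G \<theta> \<partial>M)"
  define L where "L z = F (fst z) * G (snd z)" for z
  define t where "t z k = d k \<bullet> (E (fst z) - E (snd z))" for z k
  define S where "S z = (\<Sum>k\<in>K. w k * exp (t z k))" for z
  have [measurable]: "L \<in> borel_measurable N" "(\<lambda>z. t z k) \<in> borel_measurable N" for k
    unfolding L_def t_def N_def by measurable
  have [measurable]: "S \<in> borel_measurable N"
    unfolding S_def by measurable
  have t0: "(\<Sum>k\<in>K. w k * t z k) = 0" for z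
  proof -
    have "(\<Sum>k\<in>K. w k * t z k) = (\<Sum>k\<in>K. w k *\<^sub>R d k) \<bullet> (E (fst z) - E (snd z))"
      by (simp add: t_def inner_sum_left)
    then show ?thesis by (simp add: w(3))
  qed
  have S1: "1 \<le> S z" for z
    unfolding S_def using w(1,2) t0 by (rule convex_sum_exp_ge_one)
  have L: "(\<integral>\<^sup>+z. L z \<partial>N) = C"
    unfolding L_def N_def C_def by (rule nn_integral_product_pair) (auto intro: sigma_finite_measure_axioms)
  have tilt: "(\<integral>\<^sup>+z. L z * ennreal (exp (t z k)) \<partial>N) \<le> C" if "k \<in> K" for k
  proof -
    have "L z * ennreal (exp (t z k)) =
        (F (fst z) * ennreal (exp (d k \<bullet> E (fst z)))) * (G (snd z) * ennreal (exp (- (d k \<bullet> E (snd z)))))" for z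
    proof -
      have "exp (t z k) = exp (d k \<bullet> E (fst z)) * exp (- (d k \<bullet> E (snd z)))"
        by (simp add: t_def inner_diff_right flip: exp_add)
      then show ?thesis by (simp add: L_def ennreal_mult mult_ac)
    qed
    then have "(\<integral>\<^sup>+z. L z * ennreal (exp (t z k)) \<partial>N) =
        (\<integral>\<^sup>+\<theta>. F \<theta> * ennreal (exp (d k \<bullet> E \<theta>)) \<partial>M) * (\<integral>\<^sup>+\<theta>. G \<theta> * ennreal (exp (- (d k \<bullet> E \<theta>))) \<partial>M)"
      unfolding N_def by (simp, subst nn_integral_product_pair) (auto intro: sigma_finite_measure_axioms)
    then show ?thesis using le[OF that] by (simp add: C_def)
  qed
  have "C + (\<integral>\<^sup>+z. L z * ennreal (S z - 1) \<partial>N) = (\<integral>\<^sup>+z. L z + L z * ennreal (S z - 1) \<partial>N)"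
    by (subst nn_integral_add) (auto simp: L)
  also have "\<dots> = (\<integral>\<^sup>+z. (\<Sum>k\<in>K. ennreal (w k) * (L z * ennreal (exp (t z k)))) \<partial>N)"
  proof (rule nn_integral_cong)
    fix z
    have "1 + ennreal (S z - 1) = ennreal (S z)"
      using S1[of z] by (simp flip: ennreal_plus ennreal_1)
    then have "L z + L z * ennreal (S z - 1) = L z * ennreal (S z)"
      by (metis distrib_left mult.right_neutral)
    also have "ennreal (S z) = (\<Sum>k\<in>K. ennreal (w k) * ennreal (exp (t z k)))"
      unfolding S_def using w(1) by (simp add: ennreal_mult flip: sum_ennreal)
    finally show "L z + L z * ennreal (S z - 1) = (\<Sum>k\<in>K. ennreal (w k) * (L z * ennreal (exp (t z k))))"
      by (simp add: sum_distrib_left mult_ac)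
  qed
  also have "\<dots> = (\<Sum>k\<in>K. ennreal (w k) * (\<integral>\<^sup>+z. L z * ennreal (exp (t z k)) \<partial>N))"
    by (subst nn_integral_sum) (auto simp: nn_integral_cmult)
  also have "\<dots> \<le> (\<Sum>k\<in>K. ennreal (w k) * C)"
    by (intro sum_mono mult_left_mono tilt) auto
  also have "\<dots> = C"
    using w by (simp flip: sum_distrib_right)
  finally have "(\<integral>\<^sup>+z. L z * ennreal (S z - 1) \<partial>N) = 0"
    using fin unfolding C_def[symmetric]
    by (metis add.right_neutral ennreal_add_left_cancel_le infinity_ennreal_def le_zero_eq less_irrefl)
  then have "AE z in N. L z * ennreal (S z - 1) = 0"
    by (subst (asm) nn_integral_0_iff_AE) auto
  then have "AE x in M. AE y in M. L (x, y) * ennreal (S (x, y) - 1) = 0"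
    unfolding N_def by (rule P.AE_pair)
  with posF have "AE x in M. 0 < F x \<and> (AE y in M. L (x, y) * ennreal (S (x, y) - 1) = 0)"
    by simp
  from eventually_happens'[OF ae_filter_bot this]
  obtain x where x: "0 < F x" "AE y in M. L (x, y) * ennreal (S (x, y) - 1) = 0" by blast
  from x(2) posG have "AE y in M. d k \<bullet> E y = d k \<bullet> E x"
  proof eventually_elim
    case (elim y)
    then have "S (x, y) = 1"
      using x(1) S1[of "(x, y)"] by (auto simp: L_def ennreal_eq_0_iff)
    then have "t (x, y) k = 0"
      unfolding S_def using k
      by (intro convex_sum_exp_eq_one_imp_zero[OF \<open>finite K\<close> w(1,2) t0])
    then show ?case by (simp add: t_def inner_diff_right)
  qed
  then show ?thesis by blast
qed

section \<open>Exchangeability of the partition prior\<close>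

lemma clusters_eq_image: "clusters n \<phi> = (\<lambda>i. {j\<in>{1..n}. \<phi> i = \<phi> j}) ` {1..n}"
  unfolding clusters_def quotient_def by auto

text \<open>Relabelling the sample by \<open>\<sigma>\<close> pulls the clusters back along \<open>\<sigma>\<close>, so taking images restores them.\<close>

lemma clusters_permute:
  assumes "\<sigma> permutes {1..n}"
  shows "(`) \<sigma> ` clusters n (\<lambda>i\<in>{1..n}. \<phi> (\<sigma> i)) = clusters n \<phi>"
proof -
  have 1: "\<sigma> ` {j\<in>{1..n}. (\<lambda>i\<in>{1..n}. \<phi> (\<sigma> i)) i = (\<lambda>i\<in>{1..n}. \<phi> (\<sigma> i)) j}
      = {j\<in>{1..n}. \<phi> (\<sigma> i) = \<phi> j}" if "i \<in> {1..n}" for i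
  proof -
    have "\<sigma> ` {j\<in>{1..n}. (\<lambda>i\<in>{1..n}. \<phi> (\<sigma> i)) i = (\<lambda>i\<in>{1..n}. \<phi> (\<sigma> i)) j}
        = {j\<in>\<sigma> ` {1..n}. \<phi> (\<sigma> i) = \<phi> j}"
      using that by auto
    then show ?thesis using permutes_image[OF assms] by simp
  qed
  have "(`) \<sigma> ` clusters n (\<lambda>i\<in>{1..n}. \<phi> (\<sigma> i)) = (\<lambda>i. {j\<in>{1..n}. \<phi> i = \<phi> j}) ` \<sigma> ` {1..n}"
    unfolding clusters_eq_image image_image by (rule image_cong[OF refl], rule 1)
  then show ?thesis
    unfolding clusters_eq_image permutes_image[OF assms] .
qed

text \<open>Only finitely many equality patterns on \<open>{1..n}\<close> have quotient \<open>\<I>\<close>, and each of them is a finite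
  conjunction of the measurable events \<open>\<phi> i = \<phi> j\<close> and their complements.\<close>

lemma sets_clusters_eq:
  fixes M :: "nat \<Rightarrow> 'a::euclidean_space measure"
  assumes "\<And>i. i \<in> {1..n} \<Longrightarrow> sets (M i) = sets borel"
  shows "{\<phi> \<in> space (Pi\<^sub>M {1..n} M). clusters n \<phi> = \<I>} \<in> sets (Pi\<^sub>M {1..n} M)"
proof -
  let ?A = "{1..n}"
  let ?S = "{R \<in> Pow (?A \<times> ?A). ?A // R = \<I>}"
  have eq: "clusters n \<phi> = \<I> \<longleftrightarrow> (\<exists>R\<in>?S. \<forall>i\<in>?A. \<forall>j\<in>?A. \<phi> i = \<phi> j \<longleftrightarrow> (i, j) \<in> R)" for \<phi> :: "nat \<Rightarrow> 'a"
  proof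
    assume "clusters n \<phi> = \<I>"
    then show "\<exists>R\<in>?S. \<forall>i\<in>?A. \<forall>j\<in>?A. \<phi> i = \<phi> j \<longleftrightarrow> (i, j) \<in> R"
      by (intro bexI[of _ "{(i, j). i \<in> ?A \<and> j \<in> ?A \<and> \<phi> i = \<phi> j}"]) (auto simp: clusters_def)
  next
    assume "\<exists>R\<in>?S. \<forall>i\<in>?A. \<forall>j\<in>?A. \<phi> i = \<phi> j \<longleftrightarrow> (i, j) \<in> R"
    then obtain R where R: "R \<subseteq> ?A \<times> ?A" "?A // R = \<I>" "\<forall>i\<in>?A. \<forall>j\<in>?A. \<phi> i = \<phi> j \<longleftrightarrow> (i, j) \<in> R"
      by blast
    then have "{(i, j). i \<in> ?A \<and> j \<in> ?A \<and> \<phi> i = \<phi> j} = R" by blast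
    then show "clusters n \<phi> = \<I>" using R(2) by (simp add: clusters_def)
  qed
  have "finite ?S" by simp
  have proj: "(\<lambda>\<phi>. \<phi> i) \<in> borel_measurable (Pi\<^sub>M ?A M)" if "i \<in> ?A" for i
    using measurable_component_singleton[OF that, of M] assms[OF that] by (simp cong: measurable_cong_sets)
  have eq_pred: "Measurable.pred (Pi\<^sub>M ?A M) (\<lambda>\<phi>. \<phi> i = \<phi> j)" if "i \<in> ?A" "j \<in> ?A" for i j
  proof -
    have "(\<lambda>\<phi>. \<phi> i - \<phi> j) -` {0} \<inter> space (Pi\<^sub>M ?A M) \<in> sets (Pi\<^sub>M ?A M)"
      using proj[OF that(1)] proj[OF that(2)] by (intro measurable_sets[of _ _ borel] borel_measurable_diff) auto
    also have "(\<lambda>\<phi>. \<phi> i - \<phi> j) -` {0} \<inter> space (Pi\<^sub>M ?A M) = {\<phi> \<in> space (Pi\<^sub>M ?A M). \<phi> i = \<phi> j}"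
      by auto
    finally show ?thesis unfolding pred_def .
  qed
  have "Measurable.pred (Pi\<^sub>M ?A M)
      (\<lambda>\<phi>. \<exists>R\<in>?S. \<forall>i\<in>?A. \<forall>j\<in>?A. \<phi> i = \<phi> j \<longleftrightarrow> (i, j) \<in> R)"
  proof (intro pred_intros_finite \<open>finite ?S\<close>)
    fix i j R
    assume "i \<in> ?A" "j \<in> ?A"
    note [measurable] = eq_pred[OF this]
    show "Measurable.pred (Pi\<^sub>M ?A M) (\<lambda>\<phi>. \<phi> i = \<phi> j \<longleftrightarrow> (i, j) \<in> R)"
      by measurable
  qed auto
  then show ?thesis
    unfolding eq pred_def .
qed

lemma prob_space_mixing_measure:
  assumes "p \<in> weight_simplex m"
  shows "prob_space (mixing_measure m p \<theta>)"
proof -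
  have p: "\<And>i. i \<in> components m \<Longrightarrow> 0 \<le> p i" "(p has_sum 1) (components m)"
    using assms by (auto simp: weight_simplex_def)
  have "p summable_on components m"
    using p(2) has_sum_imp_summable by blast
  then have "(\<lambda>i. norm (p i)) summable_on components m"
    by (rule summable_on_cong[THEN iffD1, rotated]) (simp add: p(1))
  then have abs: "Infinite_Set_Sum.abs_summable_on p (components m)"
    by (simp only: abs_summable_equivalent)
  have "(\<integral>\<^sup>+i. ennreal (p i) \<partial>count_space (components m)) = ennreal (infsetsum p (components m))"
    using abs p(1) by (rule nn_integral_conv_infsetsum)
  also have "\<dots> = 1"
    using infsetsum_infsum[OF abs] infsumI[OF p(2)] by simp
  finally have "prob_space (density (count_space (components m)) (\<lambda>i. ennreal (p i)))"
    by (intro prob_spaceI) (simp add: emeasure_density flip: nn_integral_restrict_space cong: nn_integral_cong_simp)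
  then show ?thesis
    unfolding mixing_measure_def by (rule prob_space.prob_space_distr) simp
qed

text \<open>Given the weights and the atoms, the \<open>\<phi> i\<close> are i.i.d., so permuting coordinates preserves their joint
  law and carries the event for \<open>\<I>\<close> to the event for its image. Equality therefore holds
  already before averaging over weights and atoms.\<close>

lemma partition_prob_permute:
  fixes \<Theta> :: "'a::euclidean_space set"
  assumes P: "distribution_on_simplex m P" and \<sigma>: "\<sigma> permutes {1..n}"
  shows "partition_prob m P \<Theta> \<pi> n ((`) \<sigma> ` \<I>) = partition_prob m P \<Theta> \<pi> n \<I>"
  unfolding partition_prob_def
proof (intro nn_integral_cong)
  fix p and \<theta> :: "nat \<Rightarrow> 'a"
  assume "p \<in> space P"
  have "space P = space (restrict_space (\<Pi>\<^sub>M i\<in>components m. borel) (weight_simplex m))"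
    using P by (intro sets_eq_imp_space_eq) (simp add: distribution_on_simplex_def)
  with \<open>p \<in> space P\<close> have "p \<in> weight_simplex m"
    by (simp add: space_restrict_space)
  define \<mu> where "\<mu> = mixing_measure m p \<theta>"
  define N where "N = (\<Pi>\<^sub>M i\<in>{1..n}. \<mu>)"
  define t where "t = (\<lambda>\<phi> :: nat \<Rightarrow> 'a. \<lambda>i\<in>{1..n}. \<phi> (\<sigma> i))"
  have "prob_space \<mu>"
    unfolding \<mu>_def by (rule prob_space_mixing_measure) fact
  have "sets \<mu> = sets borel"
    by (simp add: \<mu>_def mixing_measure_def)
  have in_range: "\<sigma> i \<in> {1..n} \<longleftrightarrow> i \<in> {1..n}" for i
    using permutes_in_image[OF \<sigma>] .
  have distr: "distr N N t = N"
    unfolding N_def t_def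
    using \<open>prob_space \<mu>\<close> \<sigma> in_range
    by (intro distr_PiM_reindex[where M = "\<lambda>_. \<mu>"]) (auto intro: permutes_inj_on)
  have t: "t \<in> measurable N N"
    unfolding t_def N_def
    by (rule measurable_restrict) (use in_range in \<open>auto intro!: measurable_component_singleton\<close>)
  have sets: "{\<phi> \<in> space N. clusters n \<phi> = \<I>} \<in> sets N"
    unfolding N_def by (rule sets_clusters_eq) (rule \<open>sets \<mu> = sets borel\<close>)
  have "inj ((`) \<sigma>)"
    by (meson \<sigma> injI inj_image_eq_iff permutes_inj)
  then have "clusters n \<phi> = (`) \<sigma> ` \<I> \<longleftrightarrow> clusters n (t \<phi>) = \<I>" for \<phi> :: "nat \<Rightarrow> 'a"
    unfolding t_def clusters_permute[OF \<sigma>, of \<phi>, symmetric] by (rule inj_image_eq_iff)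
  then have "{\<phi> \<in> space N. clusters n \<phi> = (`) \<sigma> ` \<I>} = t -` {\<phi> \<in> space N. clusters n \<phi> = \<I>} \<inter> space N"
    using measurable_space[OF t] by auto
  then have "emeasure N {\<phi> \<in> space N. clusters n \<phi> = (`) \<sigma> ` \<I>} = emeasure N {\<phi> \<in> space N. clusters n \<phi> = \<I>}"
    using emeasure_distr[OF t sets] distr by simp
  then show "emeasure (\<Pi>\<^sub>M i\<in>{1..n}. mixing_measure m p \<theta>)
        {\<phi> \<in> space (\<Pi>\<^sub>M i\<in>{1..n}. mixing_measure m p \<theta>). clusters n \<phi> = (`) \<sigma> ` \<I>} =
      emeasure (\<Pi>\<^sub>M i\<in>{1..n}. mixing_measure m p \<theta>)
        {\<phi> \<in> space (\<Pi>\<^sub>M i\<in>{1..n}. mixing_measure m p \<theta>). clusters n \<phi> = \<I>}"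
    unfolding N_def \<mu>_def .
qed

section \<open>Swapping two observations of a maximal partition\<close>

lemma MAP_score_pos_finite:
  assumes "MAP_partition m P \<Theta> \<pi> g n x \<I>"
    and "0 < evidence m P \<Theta> \<pi> g n x" "evidence m P \<Theta> \<pi> g n x < \<infinity>"
  shows "0 < posterior_score m P \<Theta> \<pi> g n x \<I>" "posterior_score m P \<Theta> \<pi> g n x \<I> < \<infinity>"
proof -
  let ?s = "posterior_score m P \<Theta> \<pi> g n x" and ?Ps = "{\<I>. partition_on {1..n} \<I>}"
  have fin: "finite ?Ps" by (rule finitely_many_partition_on) simp
  have MAP: "\<I> \<in> ?Ps" "\<And>\<J>. \<J> \<in> ?Ps \<Longrightarrow> ?s \<J> \<le> ?s \<I>"
    using assms(1) by (auto simp: MAP_partition_def)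
  obtain \<J> where "\<J> \<in> ?Ps" "?s \<J> \<noteq> 0"
    using assms(2) unfolding evidence_def by (metis (no_types, lifting) less_irrefl sum.neutral)
  with MAP(2)[of \<J>] show "0 < ?s \<I>" by (metis le_zero_eq not_gr_zero)
  have "?s \<I> \<le> evidence m P \<Theta> \<pi> g n x"
    unfolding evidence_def using fin MAP(1) by (intro member_le_sum) auto
  with assms(3) show "?s \<I> < \<infinity>" by simp
qed

text \<open>A transposition changes neither the prior probability of the partition nor the marginals of the
  clusters other than \<open>I\<close> and \<open>J\<close>. These common factors are positive and finite because the maximal score
  is, so they cancel from the inequality between the scores.\<close>

lemma MAP_swap:
  fixes \<Theta> :: "'a::euclidean_space set"
  assumes MAP: "MAP_partition m P \<Theta> \<pi> g n x \<I>" and P: "distribution_on_simplex m P"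
    and ev: "0 < evidence m P \<Theta> \<pi> g n x" "evidence m P \<Theta> \<pi> g n x < \<infinity>"
    and IJ: "I \<in> \<I>" "J \<in> \<I>" "I \<noteq> J"
  defines "f \<equiv> cluster_marginal \<Theta> \<pi> g x"
  shows "0 < f I * f J" "f I * f J < \<infinity>"
    and "\<And>i j. i \<in> I \<Longrightarrow> j \<in> J \<Longrightarrow> f (insert j (I - {i})) * f (insert i (J - {j})) \<le> f I * f J"
proof -
  let ?q = "partition_prob m P \<Theta> \<pi> n"
  define R where "R = (\<Prod>K\<in>\<I> - {I, J}. f K)"
  have part: "partition_on {1..n} \<I>"
    using MAP by (simp add: MAP_partition_def)
  have fin: "finite \<I>" using finite_elements[OF _ part] by simp
  have split: "(\<Prod>K\<in>\<I>. h K) = h I * h J * (\<Prod>K\<in>\<I> - {I, J}. h K)" for h :: "nat set \<Rightarrow> ennreal"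
  proof -
    have "\<I> - {I} - {J} = \<I> - {I, J}" by blast
    then show ?thesis
      using fin IJ by (simp add: prod.remove[of \<I> I] prod.remove[of "\<I> - {I}" J] mult_ac)
  qed
  have score: "posterior_score m P \<Theta> \<pi> g n x \<I> = ?q \<I> * (f I * f J * R)"
    unfolding posterior_score_def partition_likelihood_def f_def[symmetric] R_def by (simp only: split)
  have pos: "?q \<I> \<noteq> 0" "R \<noteq> 0" "f I * f J \<noteq> 0"
    and ltop: "?q \<I> * (f I * f J * R) < \<infinity>"
    using MAP_score_pos_finite[OF MAP ev] unfolding score by (auto simp: zero_less_iff_neq_zero)
  then have finite: "?q \<I> < \<infinity>" "R < \<infinity>" "f I * f J < \<infinity>"
    by (auto simp: ennreal_mult_less_top)
  show "0 < f I * f J" "f I * f J < \<infinity>"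
    using pos finite by (auto simp: zero_less_iff_neq_zero)
  fix i j assume ij: "i \<in> I" "j \<in> J"
  define \<sigma> where "\<sigma> = Transposition.transpose i j"
  have n: "i \<in> {1..n}" "j \<in> {1..n}"
    using partition_onD1[OF part] IJ ij by auto
  have disj: "K \<inter> K' = {}" if "K \<in> \<I>" "K' \<in> \<I>" "K \<noteq> K'" for K K'
    using partition_onD2[OF part] that by (auto simp: disjoint_def)
  have \<sigma>: "\<sigma> permutes {1..n}"
    unfolding \<sigma>_def using n by (intro permutes_swap_id)
  have notin: "i \<notin> J" "j \<notin> I" using disj[OF IJ] ij by auto
  have \<sigma>I: "\<sigma> ` I = insert j (I - {i})" and \<sigma>J: "\<sigma> ` J = insert i (J - {j})"
    using notin ij by (auto simp: \<sigma>_def Transposition.transpose_def image_def)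
  have \<sigma>K: "\<sigma> ` K = K" if "K \<in> \<I> - {I, J}" for K
  proof -
    have "i \<notin> K" "j \<notin> K" using that disj[of K I] disj[of K J] IJ ij by auto
    then show ?thesis by (auto simp: \<sigma>_def Transposition.transpose_def image_def)
  qed
  have part': "partition_on {1..n} ((`) \<sigma> ` \<I>)"
  proof -
    have "(`) \<sigma> ` \<I> - {{}} = (`) \<sigma> ` \<I>"
      using partition_onD3[OF part] by auto
    then show ?thesis
      using partition_on_inj_image[OF part permutes_inj_on[OF \<sigma>]] permutes_image[OF \<sigma>] by simp
  qed
  have "inj_on ((`) \<sigma>) \<I>"
    using permutes_inj[OF \<sigma>] by (simp add: inj_on_def inj_image_eq_iff)
  then have "posterior_score m P \<Theta> \<pi> g n x ((`) \<sigma> ` \<I>) = ?q \<I> * (\<Prod>K\<in>\<I>. f (\<sigma> ` K))"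
    unfolding posterior_score_def partition_likelihood_def partition_prob_permute[OF P \<sigma>] f_def[symmetric]
    by (simp add: prod.reindex)
  also have "(\<Prod>K\<in>\<I>. f (\<sigma> ` K)) = f (\<sigma> ` I) * f (\<sigma> ` J) * R"
    unfolding R_def using \<sigma>K by (simp only: split cong: prod.cong)
  finally have "?q \<I> * (f (\<sigma> ` I) * f (\<sigma> ` J) * R) \<le> ?q \<I> * (f I * f J * R)"
    using MAP part' score by (metis MAP_partition_def)
  then have "f (\<sigma> ` I) * f (\<sigma> ` J) * R \<le> f I * f J * R"
    using pos finite by (simp add: ennreal_mult_le_mult_iff)
  then have "R * (f (\<sigma> ` I) * f (\<sigma> ` J)) \<le> R * (f I * f J)"
    by (simp add: mult_ac)
  then have "f (\<sigma> ` I) * f (\<sigma> ` J) \<le> f I * f J"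
    using pos finite by (simp add: ennreal_mult_le_mult_iff)
  then show "f (insert j (I - {i})) * f (insert i (J - {j})) \<le> f I * f J"
    by (simp only: \<sigma>I \<sigma>J)
qed

section \<open>Cluster marginals of an exponential family\<close>

text \<open>Absorbing \<open>\<pi>\<close> into the measure turns cluster marginals into integrals over one fixed probability
  space. The integrand is taken to be some globally measurable \<open>\<gamma>\<close> that agrees with \<open>g\<close> on \<open>\<Theta>\<close>, because \<open>g\<close>
  need not be measurable in the parameter off \<open>\<Theta>\<close>.\<close>

lemma cluster_marginal_eq_nn_integral:
  fixes \<Theta> :: "'a::euclidean_space set"
  assumes \<pi>: "set_borel_measurable borel \<Theta> \<pi>" "\<And>\<theta>. \<theta> \<in> \<Theta> \<Longrightarrow> 0 \<le> \<pi> \<theta>"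
    and \<gamma>: "\<And>i. i \<in> I \<Longrightarrow> (\<lambda>\<theta>. \<gamma> \<theta> (x i)) \<in> borel_measurable borel"
    and eq: "\<And>\<theta> i. \<theta> \<in> \<Theta> \<Longrightarrow> i \<in> I \<Longrightarrow> \<gamma> \<theta> (x i) = g \<theta> (x i)"
  shows "cluster_marginal \<Theta> \<pi> g x I =
    (\<integral>\<^sup>+\<theta>. ennreal (\<Prod>i\<in>I. \<gamma> \<theta> (x i)) \<partial>density_measure \<Theta> \<pi>)"
proof -
  define \<rho> where "\<rho> = (\<lambda>\<theta>. indicator \<Theta> \<theta> * \<pi> \<theta>)"
  have [measurable]: "\<rho> \<in> borel_measurable borel"
    using \<pi>(1) by (simp add: \<rho>_def set_borel_measurable_def)
  have \<rho>: "ennreal (\<pi> \<theta>) * indicator \<Theta> \<theta> = ennreal (\<rho> \<theta>)" for \<theta>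
    by (simp add: \<rho>_def indicator_def)
  have [measurable]: "(\<lambda>\<theta>. \<Prod>i\<in>I. \<gamma> \<theta> (x i)) \<in> borel_measurable borel"
    using \<gamma> by (rule borel_measurable_prod)
  have "(\<integral>\<^sup>+\<theta>. ennreal (\<Prod>i\<in>I. \<gamma> \<theta> (x i)) \<partial>density_measure \<Theta> \<pi>)
      = (\<integral>\<^sup>+\<theta>. ennreal (\<rho> \<theta>) * ennreal (\<Prod>i\<in>I. \<gamma> \<theta> (x i)) \<partial>lborel)"
    unfolding density_measure_def \<rho> by (rule nn_integral_density) auto
  also have "\<dots> = cluster_marginal \<Theta> \<pi> g x I"
    unfolding cluster_marginal_def
  proof (rule nn_integral_cong)
    fix \<theta>
    show "ennreal (\<rho> \<theta>) * ennreal (\<Prod>i\<in>I. \<gamma> \<theta> (x i)) =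
        ennreal (\<pi> \<theta> * (\<Prod>i\<in>I. g \<theta> (x i))) * indicator \<Theta> \<theta>"
    proof (cases "\<theta> \<in> \<Theta>")
      case True
      then have "(\<Prod>i\<in>I. \<gamma> \<theta> (x i)) = (\<Prod>i\<in>I. g \<theta> (x i))"
        using eq by (intro prod.cong) auto
      with True \<pi>(2) show ?thesis by (simp add: \<rho>_def ennreal_mult')
    qed (simp add: \<rho>_def)
  qed
  finally show ?thesis by simp
qed

text \<open>The exchange keeps the number of factors, so the terms \<open>a \<bullet> Bv \<theta>\<close> cancel and only a tilt in the
  direction \<open>T (x j) - T (x i)\<close> remains.\<close>

lemma prod_expfam_exchange:
  assumes "finite I" "i \<in> I" "j \<notin> I" "h (x i) \<noteq> 0"
  shows "(\<Prod>k\<in>insert j (I - {i}). expfam_density h T \<eta> a Bv \<theta> (x k)) =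
    h (x j) / h (x i) * ((\<Prod>k\<in>I. expfam_density h T \<eta> a Bv \<theta> (x k)) * exp ((T (x j) - T (x i)) \<bullet> \<eta> \<theta>))"
proof -
  have "expfam_density h T \<eta> a Bv \<theta> (x j) =
      h (x j) / h (x i) * (expfam_density h T \<eta> a Bv \<theta> (x i) * exp ((T (x j) - T (x i)) \<bullet> \<eta> \<theta>))"
    using assms(4) by (simp add: expfam_density_def inner_diff_left algebra_simps flip: exp_add)
  then show ?thesis
    using assms(1-3) by (simp add: prod.remove[of I i])
qed

lemma borel_measurable_density_weight:
  fixes S :: "'a::euclidean_space set"
  assumes "set_borel_measurable borel S f"
  shows "(\<lambda>\<theta>. ennreal (f \<theta>) * indicator S \<theta>) \<in> borel_measurable borel"
proof -
  have "(\<lambda>\<theta>. ennreal (indicator S \<theta> * f \<theta>)) \<in> borel_measurable borel"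
    using assms by (intro measurable_compose[OF _ measurable_ennreal]) (simp add: set_borel_measurable_def)
  also have "(\<lambda>\<theta>. ennreal (indicator S \<theta> * f \<theta>)) = (\<lambda>\<theta>. ennreal (f \<theta>) * indicator S \<theta>)"
    by (auto simp: indicator_def)
  finally show ?thesis .
qed

lemma prob_space_density_measure:
  assumes "prob_density_on S f"
  shows "prob_space (density_measure S f)"
proof (rule prob_spaceI)
  have "(\<lambda>\<theta>. ennreal (f \<theta>) * indicator S \<theta>) \<in> borel_measurable borel"
    using assms by (intro borel_measurable_density_weight) (simp add: prob_density_on_def)
  then show "emeasure (density_measure S f) (space (density_measure S f)) = 1"
    using assms by (simp add: density_measure_def emeasure_density prob_density_on_def)
qed

lemma AE_density_measure_in:
  assumes "prob_density_on S f"
  shows "AE \<theta> in density_measure S f. \<theta> \<in> S"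
proof -
  have "(\<lambda>\<theta>. ennreal (f \<theta>) * indicator S \<theta>) \<in> borel_measurable borel"
    using assms by (intro borel_measurable_density_weight) (simp add: prob_density_on_def)
  then show ?thesis
    unfolding density_measure_def by (subst AE_density) (auto simp: indicator_def)
qed

section \<open>Separation of the clusters\<close>

text \<open>If the convex hulls are disjoint, compactness separates them strictly. A common point of the hulls
  has weights \<open>u\<close> on \<open>S\<close> and \<open>v\<close> on \<open>T\<close>, and their product balances the differences \<open>z - y\<close>.\<close>

lemma finite_sets_separable_or_balanced:
  fixes S T :: "'v::euclidean_space set"
  assumes "finite S" "finite T" "S \<noteq> {}" "T \<noteq> {}"
  obtains (separable) a b where "\<And>y. y \<in> S \<Longrightarrow> a \<bullet> y + b \<ge> 0" "\<And>z. z \<in> T \<Longrightarrow> a \<bullet> z + b < 0"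
  | (balanced) w where "\<And>k. k \<in> S \<times> T \<Longrightarrow> 0 \<le> w k" "sum w (S \<times> T) = 1"
      "(\<Sum>k\<in>S \<times> T. w k *\<^sub>R (snd k - fst k)) = 0"
proof (cases "convex hull S \<inter> convex hull T = {}")
  case True
  have "\<exists>a b. (\<forall>y\<in>convex hull T. a \<bullet> y < b) \<and> (\<forall>y\<in>convex hull S. b < a \<bullet> y)"
    using assms True
    by (intro separating_hyperplane_compact_closed)
       (auto intro: finite_imp_compact_convex_hull compact_imp_closed)
  then obtain a b where ab: "\<forall>y\<in>convex hull T. a \<bullet> y < b" "\<forall>y\<in>convex hull S. b < a \<bullet> y"
    by blast
  show ?thesis
  proof (rule separable)
    show "a \<bullet> y + (- b) \<ge> 0" if "y \<in> S" for y
      using ab(2) hull_inc[OF that, of convex] by force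
    show "a \<bullet> z + (- b) < 0" if "z \<in> T" for z
      using ab(1) hull_inc[OF that, of convex] by force
  qed
next
  case False
  then obtain q u v where u: "\<forall>y\<in>S. 0 \<le> u y" "sum u S = 1" "(\<Sum>y\<in>S. u y *\<^sub>R y) = q"
    and v: "\<forall>z\<in>T. 0 \<le> v z" "sum v T = 1" "(\<Sum>z\<in>T. v z *\<^sub>R z) = q"
    unfolding convex_hull_finite[OF assms(1)] convex_hull_finite[OF assms(2)] by blast
  show ?thesis
  proof (rule balanced[of "\<lambda>(y, z). u y * v z"])
    show "0 \<le> (case k of (y, z) \<Rightarrow> u y * v z)" if "k \<in> S \<times> T" for k
      using that u(1) v(1) by auto
    show "(\<Sum>(y, z)\<in>S \<times> T. u y * v z) = 1"
      using u(2) v(2) by (simp flip: sum.cartesian_product sum_distrib_left)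
    have "(\<Sum>k\<in>S \<times> T. (case k of (y, z) \<Rightarrow> u y * v z) *\<^sub>R (snd k - fst k))
        = (\<Sum>y\<in>S. \<Sum>z\<in>T. (u y * v z) *\<^sub>R (z - y))"
      unfolding sum.cartesian_product by (auto intro!: sum.cong)
    also have "\<dots> = (\<Sum>y\<in>S. u y *\<^sub>R (q - y))"
    proof (rule sum.cong[OF refl])
      fix y
      have "(\<Sum>z\<in>T. (u y * v z) *\<^sub>R (z - y)) = u y *\<^sub>R ((\<Sum>z\<in>T. v z *\<^sub>R z) - sum v T *\<^sub>R y)"
        by (simp add: scaleR_sum_right scaleR_sum_left sum_subtractf scaleR_diff_right flip: scaleR_scaleR)
      then show "(\<Sum>z\<in>T. (u y * v z) *\<^sub>R (z - y)) = u y *\<^sub>R (q - y)"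
        by (simp add: v(2,3))
    qed
    also have "\<dots> = (sum u S) *\<^sub>R q - (\<Sum>y\<in>S. u y *\<^sub>R y)"
      by (simp add: scaleR_diff_right sum_subtractf scaleR_sum_left)
    also have "\<dots> = 0" by (simp add: u(2,3))
    finally show "(\<Sum>k\<in>S \<times> T. (case k of (y, z) \<Rightarrow> u y * v z) *\<^sub>R (snd k - fst k)) = 0" .
  qed
qed

theorem theorem2p5:
  fixes X :: "(real^'d) set" and \<Theta> :: "(real^'p) set"
    and T :: "real^'d \<Rightarrow> real^'p" and h :: "real^'d \<Rightarrow> real"
    and \<eta> :: "real^'p \<Rightarrow> real^'p" and a :: "real^'q" and Bv :: "real^'p \<Rightarrow> real^'q"
    and H :: "real^'p \<Rightarrow> real" and chi :: "real^'p" and tau :: "real^'q"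
    and g :: "real^'p \<Rightarrow> real^'d \<Rightarrow> real" and \<pi> :: "real^'p \<Rightarrow> real"
    and m :: enat and P :: "(nat \<Rightarrow> real) measure"
    and n :: nat and x :: "nat \<Rightarrow> real^'d" and \<I>h :: "nat set set"
  assumes "X \<in> sets borel" and "open \<Theta>"
    and "set_borel_measurable borel X T"
    and "emeasure lborel {u \<in> X. h u \<noteq> 0} > 0"
    and "set_borel_measurable borel \<Theta> \<eta>"
    and "set_borel_measurable borel \<Theta> Bv"
    and "set_borel_measurable borel \<Theta> H"
    and g_def: "g = expfam_density h T \<eta> a Bv"
    and "\<forall>\<theta>\<in>\<Theta>. prob_density_on X (g \<theta>)"
    and "(chi, tau) \<in> Omega \<Theta> H \<eta> Bv"
    and pi_def: "\<pi> = conj_prior \<Theta> H \<eta> Bv chi tau"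
    and "prob_density_on \<Theta> \<pi>"
    and "distribution_on_simplex m P"
    and "\<forall>i\<in>{1..n}. x i \<in> X" and "inj_on x {1..n}"
    and distinguishable: "\<forall>i\<in>{1..n}. \<forall>j\<in>{1..n}. i \<noteq> j \<longrightarrow>
          \<not> (\<exists>c. AE \<theta> in density_measure \<Theta> \<pi>. (T (x i) - T (x j)) \<bullet> \<eta> \<theta> = c)"
    and posterior_exists: "0 < evidence m P \<Theta> \<pi> g n x" "evidence m P \<Theta> \<pi> g n x < \<infinity>"
    and "MAP_partition m P \<Theta> \<pi> g n x \<I>h"
  shows "linearly_separable_via T ((\<lambda>I. x ` I) ` \<I>h)"
proof -
  let ?f = "cluster_marginal \<Theta> \<pi> g x"
  define M where "M = density_measure \<Theta> \<pi>"
  \<comment> \<open>\<open>\<eta>\<close> and \<open>Bv\<close> are measurable only on \<open>\<Theta>\<close>; extending them by zero changes nothing on the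
    support of the prior and gives globally measurable integrands.\<close>
  define E where "E = (\<lambda>\<theta>. indicator \<Theta> \<theta> *\<^sub>R \<eta> \<theta>)"
  define D where "D = (\<lambda>\<theta>. indicator \<Theta> \<theta> *\<^sub>R Bv \<theta>)"
  define \<gamma> where "\<gamma> = expfam_density h T E a D"
  have E[measurable]: "E \<in> borel_measurable borel" and D[measurable]: "D \<in> borel_measurable borel"
    using assms(5,6) by (simp_all add: E_def D_def set_borel_measurable_def)
  have \<gamma>_meas[measurable]: "(\<lambda>\<theta>. \<gamma> \<theta> u) \<in> borel_measurable borel" for u
    unfolding \<gamma>_def expfam_density_def by measurable
  have \<gamma>_eq: "\<gamma> \<theta> u = g \<theta> u" if "\<theta> \<in> \<Theta>" for \<theta> u
    using that by (simp add: \<gamma>_def g_def expfam_density_def E_def D_def)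
  have M_sets[measurable_cong]: "sets M = sets borel"
    by (simp add: M_def density_measure_def)
  have M: "prob_space M"
    unfolding M_def by (rule prob_space_density_measure) fact
  interpret prob_space M by fact
  have M_in: "AE \<theta> in M. \<theta> \<in> \<Theta>"
    unfolding M_def by (rule AE_density_measure_in) fact
  obtain \<theta>0 where \<theta>0: "\<theta>0 \<in> \<Theta>"
    using eventually_happens'[OF ae_filter_bot M_in] by blast
  have f: "?f I = (\<integral>\<^sup>+\<theta>. ennreal (\<Prod>i\<in>I. \<gamma> \<theta> (x i)) \<partial>M)" for I
    unfolding M_def using assms(12) \<gamma>_eq
    by (intro cluster_marginal_eq_nn_integral) (auto simp: prob_density_on_def)
  have part: "partition_on {1..n} \<I>h"
    using assms(19) by (simp add: MAP_partition_def)
  have sub: "I \<subseteq> {1..n}" if "I \<in> \<I>h" for I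
    using partition_onD1[OF part] that by auto
  note swap = MAP_swap[OF assms(19,13) posterior_exists]
  have h_nonneg: "0 \<le> h (x i)" if "i \<in> {1..n}" for i
  proof -
    have "0 \<le> g \<theta>0 (x i)"
      using assms(9,14) \<theta>0 that by (auto simp: prob_density_on_def)
    then show ?thesis
      by (simp add: g_def expfam_density_def zero_le_mult_iff)
  qed
  have h_pos: "0 < h (x i)" if "?f I \<noteq> 0" "i \<in> I" "I \<in> \<I>h" for i I
  proof -
    have "finite I" using sub[OF that(3)] finite_subset by blast
    have "h (x i) \<noteq> 0"
    proof
      assume "h (x i) = 0"
      then have "(\<Prod>i\<in>I. \<gamma> \<theta> (x i)) = 0" for \<theta>
        using \<open>finite I\<close> that(2) by (intro prod_zero) (auto simp: \<gamma>_def expfam_density_def)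
      then show False using that(1) by (simp add: f)
    qed
    with h_nonneg[of i] sub[OF that(3)] that(2) show ?thesis by fastforce
  qed
  have "\<exists>a b. (\<forall>u\<in>x ` I. a \<bullet> T u + b \<ge> 0) \<and> (\<forall>v\<in>x ` J. a \<bullet> T v + b < 0)"
    if IJ: "I \<in> \<I>h" "J \<in> \<I>h" "I \<noteq> J" for I J
  proof -
    have fin: "finite I" "finite J"
      using sub IJ finite_subset by blast+
    have ne: "I \<noteq> {}" "J \<noteq> {}"
      using partition_onD3[OF part] IJ by auto
    have disj: "I \<inter> J = {}"
      using partition_onD2[OF part] IJ by (auto simp: disjoint_def)
    let ?S = "T ` x ` I" and ?V = "T ` x ` J"
    let ?F = "\<lambda>I \<theta>. \<Prod>i\<in>I. \<gamma> \<theta> (x i)"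
    have f_ne: "?f I \<noteq> 0" "?f J \<noteq> 0"
      using swap(1)[OF IJ] by (auto simp: zero_less_iff_neq_zero)
    have \<gamma>_pos: "0 < \<gamma> \<theta> (x i)" if "i \<in> I \<union> J" for \<theta> i
      using that h_pos f_ne IJ by (auto simp: \<gamma>_def expfam_density_def)
    have F_pos: "0 < ?F I \<theta>" "0 < ?F J \<theta>" for \<theta>
      using \<gamma>_pos by (auto intro!: prod_pos)
    \<comment> \<open>Swapping \<open>i\<close> and \<open>j\<close> multiplies the two integrands by opposite exponential tilts and by
      the reciprocal factors \<open>h (x j) / h (x i)\<close> and \<open>h (x i) / h (x j)\<close>, which cancel in the product.\<close>
    have tilt: "(\<integral>\<^sup>+\<theta>. ennreal (?F I \<theta>) * ennreal (exp ((T (x j) - T (x i)) \<bullet> E \<theta>)) \<partial>M) *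
        (\<integral>\<^sup>+\<theta>. ennreal (?F J \<theta>) * ennreal (exp (- ((T (x j) - T (x i)) \<bullet> E \<theta>))) \<partial>M) \<le> ?f I * ?f J"
      (is "?A * ?B \<le> _") if ij: "i \<in> I" "j \<in> J" for i j
    proof -
      define r where "r = h (x j) / h (x i)"
      have hij: "0 < h (x i)" "0 < h (x j)"
        using h_pos f_ne IJ ij by auto
      then have r: "0 < r" "inverse r = h (x i) / h (x j)"
        by (auto simp: r_def)
      have "?f (insert j (I - {i})) = (\<integral>\<^sup>+\<theta>. ennreal r * (ennreal (?F I \<theta>) * ennreal (exp ((T (x j) - T (x i)) \<bullet> E \<theta>))) \<partial>M)"
        unfolding f
      proof (rule nn_integral_cong)
        fix \<theta>
        have "?F (insert j (I - {i})) \<theta> = r * (?F I \<theta> * exp ((T (x j) - T (x i)) \<bullet> E \<theta>))"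
          unfolding r_def \<gamma>_def using fin disj ij hij by (intro prod_expfam_exchange) auto
        then show "ennreal (?F (insert j (I - {i})) \<theta>) = ennreal r * (ennreal (?F I \<theta>) * ennreal (exp ((T (x j) - T (x i)) \<bullet> E \<theta>)))"
          using F_pos[of \<theta>] r by (simp add: ennreal_mult)
      qed
      also have "\<dots> = ennreal r * ?A"
        by (rule nn_integral_cmult) measurable
      finally have I: "?f (insert j (I - {i})) = ennreal r * ?A" .
      have "?f (insert i (J - {j})) = (\<integral>\<^sup>+\<theta>. ennreal (inverse r) * (ennreal (?F J \<theta>) * ennreal (exp (- ((T (x j) - T (x i)) \<bullet> E \<theta>)))) \<partial>M)"
        unfolding f
      proof (rule nn_integral_cong)
        fix \<theta>
        have "?F (insert i (J - {j})) \<theta> = inverse r * (?F J \<theta> * exp ((T (x i) - T (x j)) \<bullet> E \<theta>))"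
          unfolding r \<gamma>_def using fin disj ij hij by (intro prod_expfam_exchange) auto
        also have "(T (x i) - T (x j)) \<bullet> E \<theta> = - ((T (x j) - T (x i)) \<bullet> E \<theta>)"
          by (simp add: inner_diff_left)
        finally show "ennreal (?F (insert i (J - {j})) \<theta>) =
            ennreal (inverse r) * (ennreal (?F J \<theta>) * ennreal (exp (- ((T (x j) - T (x i)) \<bullet> E \<theta>))))"
          using F_pos[of \<theta>] r(1) by (simp only: ennreal_mult less_imp_le mult_nonneg_nonneg exp_ge_zero inverse_nonnegative_iff_nonnegative)
      qed
      also have "\<dots> = ennreal (inverse r) * ?B"
        by (rule nn_integral_cmult) measurable
      finally have J: "?f (insert i (J - {j})) = ennreal (inverse r) * ?B" .
      have "ennreal r * ennreal (inverse r) = 1"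
        using r(1) by (simp flip: ennreal_mult)
      then have "?A * ?B = (ennreal r * ennreal (inverse r)) * (?A * ?B)"
        by simp
      also have "\<dots> = (ennreal r * ?A) * (ennreal (inverse r) * ?B)"
        by (simp only: mult_ac)
      also have "\<dots> \<le> ?f I * ?f J"
        using swap(3)[OF IJ ij] unfolding I J .
      finally show ?thesis .
    qed
    show ?thesis
    proof (rule finite_sets_separable_or_balanced[of ?S ?V])
      fix a b
      assume "\<And>y. y \<in> ?S \<Longrightarrow> a \<bullet> y + b \<ge> 0" "\<And>z. z \<in> ?V \<Longrightarrow> a \<bullet> z + b < 0"
      then show ?thesis by blast
    next
      \<comment> \<open>The weights are indexed by pairs of values of \<open>T\<close>, since \<open>T\<close> may identify several
        observations of one cluster; any preimages \<open>i\<close>, \<open>j\<close> will do for the swap.\<close>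
      fix w assume w: "\<And>k. k \<in> ?S \<times> ?V \<Longrightarrow> 0 \<le> w k" "sum w (?S \<times> ?V) = 1"
        "(\<Sum>k\<in>?S \<times> ?V. w k *\<^sub>R (snd k - fst k)) = 0"
      obtain k where k: "k \<in> ?S \<times> ?V" "0 < w k"
        using w(1,2) by (metis less_eq_real_def sum.neutral zero_neq_one)
      have "\<exists>c. AE \<theta> in M. (snd k - fst k) \<bullet> E \<theta> = c"
      proof (rule tilts_not_increasing_imp_AE_const[where K = "?S \<times> ?V" and w = w
            and F = "\<lambda>\<theta>. ennreal (?F I \<theta>)" and G = "\<lambda>\<theta>. ennreal (?F J \<theta>)"])
        show "(\<integral>\<^sup>+\<theta>. ennreal (?F I \<theta>) * ennreal (exp ((snd k - fst k) \<bullet> E \<theta>)) \<partial>M) *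
          (\<integral>\<^sup>+\<theta>. ennreal (?F J \<theta>) * ennreal (exp (- ((snd k - fst k) \<bullet> E \<theta>))) \<partial>M)
          \<le> (\<integral>\<^sup>+\<theta>. ennreal (?F I \<theta>) \<partial>M) * (\<integral>\<^sup>+\<theta>. ennreal (?F J \<theta>) \<partial>M)"
          if "k \<in> ?S \<times> ?V" for k
          using that tilt by (auto simp: f)
        show "(\<integral>\<^sup>+\<theta>. ennreal (?F I \<theta>) \<partial>M) * (\<integral>\<^sup>+\<theta>. ennreal (?F J \<theta>) \<partial>M) < \<infinity>"
          using swap(2)[OF IJ] by (simp add: f)
      qed (use M w k fin F_pos in \<open>auto simp del: mem_Sigma_iff\<close>)
      then obtain c where c: "AE \<theta> in M. (snd k - fst k) \<bullet> E \<theta> = c" by blast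
      obtain i j where ij: "i \<in> I" "j \<in> J" and k_eq: "k = (T (x i), T (x j))"
        using k(1) by auto
      have "AE \<theta> in density_measure \<Theta> \<pi>. (T (x j) - T (x i)) \<bullet> \<eta> \<theta> = c"
        using c M_in unfolding M_def[symmetric] by eventually_elim (simp add: k_eq E_def)
      moreover have "i \<in> {1..n}" "j \<in> {1..n}" "j \<noteq> i"
        using ij sub[OF IJ(1)] sub[OF IJ(2)] disj by blast+
      ultimately show ?thesis
        using distinguishable by blast
    qed (use fin ne in auto)
  qed
  then show ?thesis
    unfolding linearly_separable_via_def by blast
qed

end
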